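(* Let $G=(\mathcal V,\mathcal E)$ be a simple directed graph with $n\ge 2$ nodes and no self-loops, let $f\ge 0$ be an integer, and let $\mu<U$ be real constants. Suppose that a correct IABC algorithm (iterative approximate Byzantine consensus algorithm, as defined in the context) exists for $G$ in the presence of up to $f$ faulty links per iteration. Then $G$ satisfies Condition P.
   Context: Graph: $\mathcal V=\{1,\dots,n\}$, $\mathcal E$ is a set of ordered pairs $(i,j)$ with $i\ne j$. $N_i^-=\{j : (j,i)\in\mathcal E\}$ and $N_i^+=\{j:(i,j)\in\mathcal E\}$. Failure model (transient Byzantine links): the system is synchronous and proceeds in iterations $t=1,2,\dots$. All nodes are fault-free. In each iteration $t$ an omniscient adversary (knowing the algorithm, the topology, all states and all messages) chooses a set $F[t]\subseteq\mathcal E$ with $|F[t]|\le f$ of faulty links; the set may differ from iteration to iteration. A faulty link $(j,i)$ may deliver to $i$ an arbitrary value or drop the message; a non-faulty link delivers exactly the message sent. Nodes do not know which links are faulty. IABC algorithm: each node $i$ has a real state $v_i[t]$ at the end of iteration $t$; $v_i[0]\in[\mu,U]$ is its input, where $\mu,U$ are known a priori. The algorithm is specified by transition functions $T_i$ (one per node, the same in all iterations) and a finite number $t_{end}$ of iterations after which it terminates. In iteration $t\ge1$: (1) every node $i$ transmits $v_i[t-1]$ to all nodes in $N_i^+$; (2) node $i$ receives a vector $r_i[t]$ of values indexed by $N_i^-$ (an entry may be marked missing if the message was dropped by a faulty link); (3) node $i$ sets $v_i[t]=T_i(r_i[t],v_i[t-1])$. For $\varepsilon>0$, the algorithm is correct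 with parameter $\varepsilon$ if for all inputs in $[\mu,U]$ and all adversary behaviors: (Termination) it terminates after a finite number $t_{end}$ of iterations; (Validity) for every iteration $t>0$, $\min_{i}v_i[t]\ge\min_i v_i[t-1]$ and $\max_i v_i[t]\le\max_i v_i[t-1]$; ($\varepsilon$-agreement) $|v_i[t_{end}]-v_j[t_{end}]|<\varepsilon$ for all $i,j\in\mathcal V$. "A correct IABC algorithm exists for $G$" means that for every $\varepsilon>0$ there is an IABC algorithm that is correct with parameter $\varepsilon$. For non-empty disjoint node sets $A,B$ in a directed graph, $A\Rightarrow B$ means that some node $i\in B$ has at least $f+1$ incoming links from nodes in $A$ in that graph. Condition P: for every $F\subseteq\mathcal E$ with $|F|\le f$ and every partition of $\mathcal V$ into sets $L,C,R$ with $L$ and $R$ non-empty ($C$ possibly empty), in the graph $G'=(\mathcal V,\mathcal E\setminus F)$ at least one of the following holds: (i) $C\cup R\Rightarrow L$; (ii) $L\cup C\Rightarrow R$. *)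

theory Defs
  imports Complex_Main "Graph_Theory.Pair_Digraph"
begin

definition in_nbrs :: "'a pair_pre_digraph \<Rightarrow> 'a \<Rightarrow> 'a set" where
  "in_nbrs G i = {j. (j, i) \<in> parcs G}"

text \<open>
  A vector of received values indexed by the in-neighbours of a node is a partial map whose domain
  lies in the set of in-neighbours; the value \<^term>\<open>None\<close> at an in-neighbour marks a dropped message.
  The transition functions do not take the iteration number as an argument.
\<close>

record 'a iabc =
  trans :: "'a \<Rightarrow> ('a \<rightharpoonup> real) \<Rightarrow> real \<Rightarrow> real"
  t_end :: nat

text \<open>
  \<open>F t\<close> is the set of links that are faulty in iteration \<open>t\<close>, \<open>r t i\<close> the vector received by node
  \<open>i\<close> in iteration \<open>t\<close>, and \<open>v t i\<close> the state of node \<open>i\<close> at the end of iteration \<open>t\<close> (its input for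
  \<open>t = 0\<close>). Entries of \<open>r t i\<close> for faulty links are unconstrained. Only the iterations
  \<open>1, \<dots>, t_end A\<close> take place; the sequences are irrelevant beyond them.
\<close>

definition iabc_execution ::
  "'a pair_pre_digraph \<Rightarrow> nat \<Rightarrow> real \<Rightarrow> real \<Rightarrow> 'a iabc \<Rightarrow>
   (nat \<Rightarrow> ('a \<times> 'a) set) \<Rightarrow> (nat \<Rightarrow> 'a \<Rightarrow> 'a \<rightharpoonup> real) \<Rightarrow> (nat \<Rightarrow> 'a \<Rightarrow> real) \<Rightarrow> bool" where
  "iabc_execution G f \<mu> U A F r v \<longleftrightarrow>
     (\<forall>i \<in> pverts G. v 0 i \<in> {\<mu>..U}) \<and>
     (\<forall>t \<in> {1..t_end A}.
        F t \<subseteq> parcs G \<and> card (F t) \<le> f \<and>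
        (\<forall>i \<in> pverts G. dom (r t i) \<subseteq> in_nbrs G i) \<and>
        (\<forall>(j, i) \<in> parcs G - F t. r t i j = Some (v (t - 1) j)) \<and>
        (\<forall>i \<in> pverts G. v t i = trans A i (r t i) (v (t - 1) i)))"

definition validity :: "'a pair_pre_digraph \<Rightarrow> nat \<Rightarrow> (nat \<Rightarrow> 'a \<Rightarrow> real) \<Rightarrow> bool" where
  "validity G T v \<longleftrightarrow>
     (\<forall>t \<in> {1..T}. Min (v t ` pverts G) \<ge> Min (v (t - 1) ` pverts G) \<and>
                   Max (v t ` pverts G) \<le> Max (v (t - 1) ` pverts G))"

definition eps_agreement :: "'a pair_pre_digraph \<Rightarrow> nat \<Rightarrow> real \<Rightarrow> (nat \<Rightarrow> 'a \<Rightarrow> real) \<Rightarrow> bool" where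
  "eps_agreement G T \<epsilon> v \<longleftrightarrow> (\<forall>i \<in> pverts G. \<forall>j \<in> pverts G. \<bar>v T i - v T j\<bar> < \<epsilon>)"

text \<open>
  Termination needs no clause of its own: an algorithm stops after the fixed finite number
  \<^term>\<open>t_end A\<close> of iterations in every execution.
\<close>

definition iabc_correct ::
  "'a pair_pre_digraph \<Rightarrow> nat \<Rightarrow> real \<Rightarrow> real \<Rightarrow> real \<Rightarrow> 'a iabc \<Rightarrow> bool" where
  "iabc_correct G f \<mu> U \<epsilon> A \<longleftrightarrow>
     (\<forall>F r v. iabc_execution G f \<mu> U A F r v \<longrightarrow>
        validity G (t_end A) v \<and> eps_agreement G (t_end A) \<epsilon> v)"

definition correct_iabc_exists :: "'a pair_pre_digraph \<Rightarrow> nat \<Rightarrow> real \<Rightarrow> real \<Rightarrow> bool" where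
  "correct_iabc_exists G f \<mu> U \<longleftrightarrow> (\<forall>\<epsilon>>0. \<exists>A. iabc_correct G f \<mu> U \<epsilon> A)"

text \<open>The relation written \<open>A \<Rightarrow> B\<close> for the graph \<open>G\<close>, intended for non-empty disjoint \<open>A\<close> and \<open>B\<close>.\<close>

definition links_into :: "'a pair_pre_digraph \<Rightarrow> nat \<Rightarrow> 'a set \<Rightarrow> 'a set \<Rightarrow> bool" where
  "links_into G f A B \<longleftrightarrow> (\<exists>i \<in> B. card {j \<in> A. (j, i) \<in> parcs G} \<ge> f + 1)"

definition condition_P :: "'a pair_pre_digraph \<Rightarrow> nat \<Rightarrow> bool" where
  "condition_P G f \<longleftrightarrow>
     (\<forall>F L C R.
        F \<subseteq> parcs G \<and> card F \<le> f \<and>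
        L \<union> C \<union> R = pverts G \<and> L \<inter> C = {} \<and> L \<inter> R = {} \<and> C \<inter> R = {} \<and>
        L \<noteq> {} \<and> R \<noteq> {} \<longrightarrow>
        (let G' = G\<lparr>parcs := parcs G - F\<rparr> in
           links_into G' f (C \<union> R) L \<or> links_into G' f (L \<union> C) R))"

end

theory Submission
  imports Defs
begin

text \<open>
  A node whose state is \<open>c\<close> and which hears \<open>c\<close> on all but at most \<open>f\<close> incoming links must keep the
  state \<open>c\<close>: its view is also possible when every node has state \<open>c\<close> and only the deviating links are
  faulty, and then validity forces \<open>c\<close>. If Condition P fails for \<open>F, L, C, R\<close>, give \<open>L\<close> the input
  \<open>\<mu>\<close> and \<open>R\<close> the input \<open>U\<close>, and let the links in \<open>F\<close> deliver \<open>\<mu>\<close> to \<open>L\<close> and \<open>U\<close> to \<open>R\<close> in every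
  iteration. Both sides are then stuck forever, contradicting agreement for \<open>\<epsilon> = U - \<mu>\<close>.
\<close>

text \<open>The attack needs no adaptivity: the faulty links and what they deliver stay the same in
  all iterations, so \<open>F\<close> and \<open>x\<close> carry no time index.\<close>

definition received ::
  "'a pair_pre_digraph \<Rightarrow> ('a \<times> 'a) set \<Rightarrow> ('a \<Rightarrow> 'a \<rightharpoonup> real) \<Rightarrow> ('a \<Rightarrow> real) \<Rightarrow> 'a \<Rightarrow> 'a \<rightharpoonup> real" where
  "received G F x w i j =
     (if (j, i) \<in> F then x i j else if (j, i) \<in> parcs G then Some (w j) else None)"

primrec run ::
  "'a pair_pre_digraph \<Rightarrow> 'a iabc \<Rightarrow> ('a \<times> 'a) set \<Rightarrow> ('a \<Rightarrow> 'a \<rightharpoonup> real) \<Rightarrow> ('a \<Rightarrow> real) \<Rightarrow>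
   nat \<Rightarrow> 'a \<Rightarrow> real" where
  "run G A F x w 0 = w"
| "run G A F x w (Suc t) =
     (\<lambda>i. trans A i (received G F x (run G A F x w t) i) (run G A F x w t i))"

lemma iabc_execution_run:
  assumes "\<And>i. i \<in> pverts G \<Longrightarrow> w i \<in> {\<mu>..U}" and "F \<subseteq> parcs G" and "card F \<le> f"
  shows "iabc_execution G f \<mu> U A (\<lambda>_. F)
    (\<lambda>t. received G F x (run G A F x w (t - 1))) (run G A F x w)"
  unfolding iabc_execution_def
proof (intro conjI ballI)
  fix t i assume "t \<in> {1..t_end A}"
  then show "run G A F x w t i
      = trans A i (received G F x (run G A F x w (t - 1)) i) (run G A F x w (t - 1) i)"
    by (cases t) simp_all
next
  fix t i
  show "dom (received G F x (run G A F x w (t - 1)) i) \<subseteq> in_nbrs G i"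
    using assms(2) by (auto simp: received_def in_nbrs_def split: if_splits)
qed (use assms in \<open>auto simp: received_def\<close>)

lemma iabc_correct_run:
  assumes "iabc_correct G f \<mu> U \<epsilon> A"
    and "\<And>i. i \<in> pverts G \<Longrightarrow> w i \<in> {\<mu>..U}" and "F \<subseteq> parcs G" and "card F \<le> f"
  shows "validity G (t_end A) (run G A F x w)" and "eps_agreement G (t_end A) \<epsilon> (run G A F x w)"
proof -
  have "iabc_execution G f \<mu> U A (\<lambda>_. F)
      (\<lambda>t. received G F x (run G A F x w (t - 1))) (run G A F x w)"
    by (rule iabc_execution_run) (fact assms)+
  then show "validity G (t_end A) (run G A F x w)"
    and "eps_agreement G (t_end A) \<epsilon> (run G A F x w)"
    using assms(1) unfolding iabc_correct_def by blast+
qed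

lemma trans_eq_state:
  assumes correct: "iabc_correct G f \<mu> U \<epsilon> A" and "t_end A \<ge> 1"
    and fin: "finite (pverts G)" and "i \<in> pverts G" and "c \<in> {\<mu>..U}"
    and dom: "dom r \<subseteq> in_nbrs G i"
    and few: "card {j. (j, i) \<in> parcs G \<and> r j \<noteq> Some c} \<le> f"
  shows "trans A i r c = c"
proof -
  let ?B = "{j. (j, i) \<in> parcs G \<and> r j \<noteq> Some c}"
  define F where "F = (\<lambda>j. (j, i)) ` ?B"
  \<comment> \<open>All links in \<open>F\<close> enter \<open>i\<close>, so offering
    \<open>r\<close> to every node affects only \<open>i\<close>.\<close>
  define v where "v = run G A F (\<lambda>_. r) (\<lambda>_. c)"
  have "F \<subseteq> parcs G" "card F \<le> f"
    using few by (auto simp: F_def card_image inj_on_def)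
  then have "validity G (t_end A) v"
    unfolding v_def using \<open>c \<in> {\<mu>..U}\<close> by (intro iabc_correct_run(1)[OF correct])
  \<comment> \<open>Validity constrains iteration 1 only because \<open>t_end A\<close> is at least
    1.\<close>
  then have "Min (v 1 ` pverts G) \<ge> Min (v 0 ` pverts G)"
    and "Max (v 1 ` pverts G) \<le> Max (v 0 ` pverts G)"
    using \<open>t_end A \<ge> 1\<close> unfolding validity_def by force+
  moreover have "v 0 ` pverts G = {c}"
    using \<open>i \<in> pverts G\<close> by (auto simp: v_def)
  moreover have "Min (v 1 ` pverts G) \<le> v 1 i" "v 1 i \<le> Max (v 1 ` pverts G)"
    using fin \<open>i \<in> pverts G\<close> by auto
  ultimately have "v 1 i = c"
    by simp
  moreover have "received G F (\<lambda>_. r) (\<lambda>_. c) i = r"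
  proof (rule ext)
    fix j
    show "received G F (\<lambda>_. r) (\<lambda>_. c) i j = r j"
    proof (cases "(j, i) \<in> parcs G")
      case True
      then show ?thesis by (cases "r j = Some c") (auto simp: received_def F_def)
    next
      case False
      then have "r j = None" using dom by (auto simp: in_nbrs_def)
      with False show ?thesis by (auto simp: received_def F_def)
    qed
  qed
  ultimately show ?thesis
    by (simp add: v_def)
qed

text \<open>Stated for one set \<open>S\<close> so that it serves both sides of the partition. The
  links that deviate from \<open>c\<close> are in fact fault-free links from outside
  \<open>S\<close>, but there are too few of them for a node of \<open>S\<close> to rule out that
  they are the faulty ones.\<close>

lemma run_eq_const:
  assumes correct: "iabc_correct G f \<mu> U \<epsilon> A"
    and wf: "pair_digraph G" and "F \<subseteq> parcs G"
    and "S \<subseteq> pverts G" and "c \<in> {\<mu>..U}"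
    and few: "\<not> links_into (G\<lparr>parcs := parcs G - F\<rparr>) f (pverts G - S) S"
    and x: "\<And>i j. i \<in> S \<Longrightarrow> x i j = Some c" and w: "\<And>i. i \<in> S \<Longrightarrow> w i = c"
    and "t \<le> t_end A" and "i \<in> S"
  shows "run G A F x w t i = c"
  using assms(9,10)
proof (induction t arbitrary: i)
  case 0
  then show ?case by (simp add: w)
next
  case (Suc t)
  interpret pair_digraph G by (fact wf)
  let ?r = "received G F x (run G A F x w t) i"
  let ?D = "{j \<in> pverts G - S. (j, i) \<in> parcs G - F}"
  have "card ?D \<le> f"
    using few \<open>i \<in> S\<close> unfolding links_into_def by force
  \<comment> \<open>Links in \<open>F\<close> deliver \<open>c\<close> by the choice of
    \<open>x\<close>, and fault-free links from inside \<open>S\<close> carry \<open>c\<close> by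
    the induction hypothesis.\<close>
  moreover have "{j. (j, i) \<in> parcs G \<and> ?r j \<noteq> Some c} \<subseteq> ?D"
    using Suc x by (auto simp: received_def in_arcsD1 split: if_splits)
  then have "card {j. (j, i) \<in> parcs G \<and> ?r j \<noteq> Some c} \<le> card ?D"
    by (intro card_mono) auto
  moreover have "dom ?r \<subseteq> in_nbrs G i"
    using \<open>F \<subseteq> parcs G\<close> by (auto simp: received_def in_nbrs_def split: if_splits)
  ultimately have "trans A i ?r c = c"
    using Suc.prems assms(4,5) by (intro trans_eq_state[OF correct]) auto
  then show ?case
    using Suc by simp
qed

theorem theorem1:
  fixes G :: "nat pair_pre_digraph" and n f :: nat and \<mu> U :: real
  assumes "pair_digraph G"
    and "pverts G = {1..n}"
    and "n \<ge> 2"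
    and "\<mu> < U"
    and "correct_iabc_exists G f \<mu> U"
  shows "condition_P G f"
proof (rule ccontr)
  assume "\<not> condition_P G f"
  then obtain F L C R where F: "F \<subseteq> parcs G" "card F \<le> f"
    and part: "L \<union> C \<union> R = pverts G" "L \<inter> C = {}" "L \<inter> R = {}" "C \<inter> R = {}" "L \<noteq> {}" "R \<noteq> {}"
    and "\<not> links_into (G\<lparr>parcs := parcs G - F\<rparr>) f (C \<union> R) L"
    and "\<not> links_into (G\<lparr>parcs := parcs G - F\<rparr>) f (L \<union> C) R"
    unfolding condition_P_def Let_def by blast
  moreover have "C \<union> R = pverts G - L" "L \<union> C = pverts G - R"
    using part by blast+
  ultimately have few: "\<not> links_into (G\<lparr>parcs := parcs G - F\<rparr>) f (pverts G - L) L"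
    "\<not> links_into (G\<lparr>parcs := parcs G - F\<rparr>) f (pverts G - R) R"
    by simp_all
  obtain A where A: "iabc_correct G f \<mu> U (U - \<mu>) A"
    using assms(4,5) unfolding correct_iabc_exists_def by (meson diff_gt_0_iff_gt)
  \<comment> \<open>The input of \<open>C\<close> is immaterial as long as it lies in the range;
    here it is \<open>U\<close>.\<close>
  define w where "w i = (if i \<in> L then \<mu> else U)" for i
  \<comment> \<open>A faulty link echoes the receiver's own input.\<close>
  define x where "x i j = Some (w i)" for i j :: nat
  obtain l r where lr: "l \<in> L" "r \<in> R"
    using part by blast
  have "run G A F x w (t_end A) l = \<mu>"
    using part lr assms(4)
    by (intro run_eq_const[OF A assms(1) F(1) _ _ few(1)]) (auto simp: x_def w_def)
  moreover have "run G A F x w (t_end A) r = U"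
    using part lr assms(4)
    by (intro run_eq_const[OF A assms(1) F(1) _ _ few(2)]) (auto simp: x_def w_def)
  moreover have "eps_agreement G (t_end A) (U - \<mu>) (run G A F x w)"
    using assms(4) by (intro iabc_correct_run(2)[OF A _ F]) (auto simp: w_def)
  moreover have "l \<in> pverts G" "r \<in> pverts G"
    using lr part(1) by blast+
  \<comment> \<open>Agreement is strict, so a final gap of exactly \<open>U - \<mu>\<close> violates
    it. If \<open>t_end A\<close> is 0, the inputs themselves do.\<close>
  ultimately have "\<bar>\<mu> - U\<bar> < U - \<mu>"
    unfolding eps_agreement_def by metis
  then show False
    by simp
qed

end
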